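(* Let $(\phi_t)$ be a one-parameter semigroup in $\mathbb D$ with infinitesimal generator $G$ and Kœnigs function $h$. Suppose $x\in\partial\mathbb D$ is a regular singularity of $G$ of order $\alpha\in[-1,1)\setminus\{0\}$. Then $h(x)\in\mathbb C$, the limit $\nu:=\lim_{r\to1^-}\frac{h(x)-h(rx)}{|h(x)-h(rx)|}$ exists, and with $S(\theta,\rho):=\{h(x)-\nu\varrho e^{i\vartheta}:|\vartheta|<\theta/2,\ 0<\varrho<\rho\}$: (i) for every $\theta\in(0,(1-\alpha)\pi)$ there is $\rho>0$ with $S(\theta,\rho)\subset h(\mathbb D)$; (ii) for every $\theta>(1-\alpha)\pi$ and every $\rho>0$, $S(\theta,\rho)\not\subset h(\mathbb D)$.
   Context: One-parameter semigroup $(\phi_t)$ in $\mathbb D$: continuous homomorphism from $([0,\infty),+)$ to holomorphic self-maps of $\mathbb D$ under composition, none an automorphism for $t>0$; generator $G$ with $\partial_t\phi_t=G\circ\phi_t$; Denjoy–Wolff point $\tau=\lim_{t\to\infty}\phi_t$. Kœnigs function: the univalent $h$ with $h(\tau)=0,h'(\tau)=1,h\circ\phi_t=e^{G'(\tau)t}h$ if $\tau\in\mathbb D$, and $h(0)=0$, $h\circ\phi_t=h+t$ if $\tau\in\partial\mathbb D$; $h(x)$ is its angular limit at $x$. $G$ has a regular singularity of order $\alpha$ at $x$ if $\lim_{r\to1^-}G(rx)/(1-r)^\alpha$ exists in $\mathbb C\setminus\{0\}$. *)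

theory Defs
  imports "HOL-Analysis.Analysis"
begin

definition unit_disc :: "complex set" where
  "unit_disc = ball 0 1"

text \<open>One-parameter semigroup of holomorphic self-maps of the disc: a continuous
  homomorphism t \<mapsto> phi t from ([0,\<infinity>),+) to holomorphic self-maps of the disc under
  composition (continuity w.r.t. locally uniform convergence, i.e. joint continuity),
  with no phi t (t>0) an automorphism of the disc.\<close>
definition one_param_semigroup :: "(real \<Rightarrow> complex \<Rightarrow> complex) \<Rightarrow> bool" where
  "one_param_semigroup \<phi> \<longleftrightarrow>
     (\<forall>t\<ge>0. \<phi> t holomorphic_on unit_disc \<and> \<phi> t ` unit_disc \<subseteq> unit_disc) \<and>
     (\<forall>z\<in>unit_disc. \<phi> 0 z = z) \<and>
     (\<forall>s\<ge>0. \<forall>t\<ge>0. \<forall>z\<in>unit_disc. \<phi> (s + t) z = \<phi> s (\<phi> t z)) \<and>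
     continuous_on ({0..} \<times> unit_disc) (\<lambda>(t, z). \<phi> t z) \<and>
     (\<forall>t>0. \<not> bij_betw (\<phi> t) unit_disc unit_disc)"

definition is_generator :: "(real \<Rightarrow> complex \<Rightarrow> complex) \<Rightarrow> (complex \<Rightarrow> complex) \<Rightarrow> bool" where
  "is_generator \<phi> G \<longleftrightarrow> G holomorphic_on unit_disc \<and>
     (\<forall>t\<ge>0. \<forall>z\<in>unit_disc.
        ((\<lambda>s. \<phi> s z) has_vector_derivative G (\<phi> t z)) (at t within {0..}))"

definition denjoy_wolff_point :: "(real \<Rightarrow> complex \<Rightarrow> complex) \<Rightarrow> complex \<Rightarrow> bool" where
  "denjoy_wolff_point \<phi> \<tau> \<longleftrightarrow> cmod \<tau> \<le> 1 \<and>
     (\<forall>z\<in>unit_disc. ((\<lambda>t. \<phi> t z) \<longlongrightarrow> \<tau>) at_top)"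

definition koenigs_function ::
  "(real \<Rightarrow> complex \<Rightarrow> complex) \<Rightarrow> (complex \<Rightarrow> complex) \<Rightarrow> complex \<Rightarrow> (complex \<Rightarrow> complex) \<Rightarrow> bool" where
  "koenigs_function \<phi> G \<tau> h \<longleftrightarrow>
     h holomorphic_on unit_disc \<and> inj_on h unit_disc \<and>
     (if \<tau> \<in> unit_disc then
        h \<tau> = 0 \<and> deriv h \<tau> = 1 \<and>
        (\<forall>t\<ge>0. \<forall>z\<in>unit_disc. h (\<phi> t z) = exp (deriv G \<tau> * of_real t) * h z)
      else
        h 0 = 0 \<and> (\<forall>t\<ge>0. \<forall>z\<in>unit_disc. h (\<phi> t z) = h z + of_real t))"

definition angular_limit :: "(complex \<Rightarrow> complex) \<Rightarrow> complex \<Rightarrow> complex \<Rightarrow> bool" where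
  "angular_limit f x L \<longleftrightarrow>
     (\<forall>K>1. (f \<longlongrightarrow> L) (at x within {z \<in> unit_disc. cmod (x - z) < K * (1 - cmod z)}))"

definition regular_singularity :: "(complex \<Rightarrow> complex) \<Rightarrow> complex \<Rightarrow> real \<Rightarrow> bool" where
  "regular_singularity G x \<alpha> \<longleftrightarrow>
     (\<exists>c. c \<noteq> 0 \<and>
        ((\<lambda>r. G (of_real r * x) / of_real ((1 - r) powr \<alpha>)) \<longlongrightarrow> c) (at_left 1))"

definition sector :: "complex \<Rightarrow> complex \<Rightarrow> real \<Rightarrow> real \<Rightarrow> complex set" where
  "sector hx \<nu> \<theta> \<rho> = {hx - \<nu> * of_real r * cis a | a r. \<bar>a\<bar> < \<theta> / 2 \<and> 0 < r \<and> r < \<rho>}"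

end

theory Submission
  imports Defs "HOL-Complex_Analysis.Complex_Analysis"
begin

text \<open>Differentiating the functional equation of \<open>h\<close> at \<open>t = 0\<close> gives \<open>h' G = 1\<close> or
  \<open>h' G = G'(\<tau>) h\<close>.  Integrating along the radius, \<open>h(x) - h(rx) \<sim> C (1 - r) powr (1 - \<alpha>)\<close> with
  \<open>C \<noteq> 0\<close>.  From here on only the univalence of \<open>f = h(x) - h\<close>, which has no zero in the disc, is used:
  it makes the rescalings of \<open>f\<close> at \<open>x\<close> a normal family, whose limit must be
  \<open>\<zeta> powr (1 - \<alpha>)\<close> on the right half-plane, and Hurwitz's theorem yields the sectors in (i).  For (ii),
  a larger sector in the image is excluded by the Schwarz--Pick lemma applied to the inverse of \<open>f\<close>.\<close>

text \<open>The asymptotics of \<open>h\<close> hold on one radius only, while a sector with its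
  vertex at h(x) involves all directions and arbitrarily small scales. Univalence closes this gap:
  the logarithm of a zero-free univalent function has derivative at most a constant over the
  distance to the boundary, so a bound at one point spreads to compact sets with constants that do
  not depend on the scale. Any finite constant will do, hence Bloch's theorem in place of the sharp
  Koebe theorem. If \<tau> lies inside the disc, the equation h' G = G'(\<tau>) h has the unknown on
  both sides. Integrating log h near x first shows that h has a finite nonzero limit along the
  radius; after that the equation has the same shape as in the boundary case. The angle (1 -
  \<alpha>) \<pi> is the opening of the image of the right half-plane under the power 1 - \<alpha>,
  which lies in (0, 2]. The modulus of C only rescales the picture; its direction
  \<open>sgn C\<close> is the limit \<nu>.\<close>

section \<open>Distortion of zero-free univalent functions\<close>

lemma deriv_holomorphic_log:
  assumes L: "L holomorphic_on D" and D: "open D"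
    and exp: "\<And>z. z \<in> D \<Longrightarrow> exp (L z) = f z" and nz: "\<And>z. z \<in> D \<Longrightarrow> f z \<noteq> 0" and a: "a \<in> D"
  shows "deriv L a = deriv f a / f a"
proof -
  have "(L has_field_derivative deriv L a) (at a)"
    using L a D holomorphic_derivI by blast
  then have "((\<lambda>z. exp (L z)) has_field_derivative exp (L a) * deriv L a) (at a)"
    by (auto intro!: derivative_eq_intros)
  then have "(f has_field_derivative exp (L a) * deriv L a) (at a)"
    by (rule has_field_derivative_transform_within_open[of _ _ _ D]) (use exp D a in auto)
  then show ?thesis
    using exp[OF a] nz[OF a] by (simp add: DERIV_imp_deriv)
qed

text \<open>A weak Koebe distortion estimate: by Bloch's theorem a large logarithmic derivative would make
  the image of a logarithm of \<open>f\<close> contain two points that differ by \<open>2 \<pi> i\<close>.\<close>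

lemma univalent_log_deriv_bound:
  assumes hol: "f holomorphic_on ball a R" and inj: "inj_on f (ball a R)"
    and nz: "\<And>z. z \<in> ball a R \<Longrightarrow> f z \<noteq> 0" and R: "R > 0"
  shows "R * cmod (deriv f a / f a) \<le> 12 * pi"
proof (rule ccontr)
  assume "\<not> ?thesis"
  \<comment> \<open>Bloch's theorem provides a disc of radius R |L'(a)| / 12 in the image of L. The
    bound 12 \<pi> is what makes this radius exceed \<pi>, so that both b + i \<pi> and b - i \<pi>
    fit in.\<close>
  then have big: "pi < R * cmod (deriv f a / f a) / 12" by simp
  have a: "a \<in> ball a R" using R by simp
  obtain L where L: "L holomorphic_on ball a R" "\<And>z. z \<in> ball a R \<Longrightarrow> exp (L z) = f z"
    using holomorphic_logarithm_exists[OF convex_ball open_ball hol nz a] by blast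
  have "deriv L a = deriv f a / f a"
    by (rule deriv_holomorphic_log[OF L(1) open_ball L(2) nz a])
  with big have "pi < R * cmod (deriv L a) / 12" by simp
  obtain b where b: "ball b (R * cmod (deriv L a) / 12) \<subseteq> L ` ball a R"
    using Bloch[OF L(1) R order_refl] by blast
  have "b + \<i> * pi \<in> ball b (R * cmod (deriv L a) / 12)" "b - \<i> * pi \<in> ball b (R * cmod (deriv L a) / 12)"
    using \<open>pi < R * cmod (deriv L a) / 12\<close> by (auto simp: dist_norm norm_mult)
  then obtain u v where u: "u \<in> ball a R" "L u = b + \<i> * pi" and v: "v \<in> ball a R" "L v = b - \<i> * pi"
    using b[THEN subsetD] by (metis imageE)
  have "f u = f v"
    using L(2)[OF u(1)] L(2)[OF v(1)] u(2) v(2) by (simp add: exp_add exp_diff)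
  then have "u = v" using inj_onD[OF inj] u(1) v(1) by blast
  with u v show False by simp
qed

text \<open>Integrate the bound 12 \<pi> / d on the logarithmic derivative along the segment. This
  is a Harnack-type inequality: the exponent is the length of the segment measured in units of its
  distance to the boundary. Only the real part of the logarithm enters, so the choice of branch is
  immaterial.\<close>

lemma univalent_growth_bound:
  assumes hol: "f holomorphic_on D" and inj: "inj_on f D" and D: "open D" "convex D"
    and nz: "\<And>z. z \<in> D \<Longrightarrow> f z \<noteq> 0" and d: "d > 0"
    and seg: "\<And>u. u \<in> closed_segment w z \<Longrightarrow> ball u d \<subseteq> D"
  shows "cmod (f z) \<le> cmod (f w) * exp (12 * pi / d * cmod (z - w))"
proof -
  have sub: "closed_segment w z \<subseteq> D" using seg d by force
  have w: "w \<in> D" and z: "z \<in> D" using sub by auto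
  obtain L where L: "L holomorphic_on D" "\<And>z. z \<in> D \<Longrightarrow> exp (L z) = f z"
    using holomorphic_logarithm_exists[OF D(2,1) hol nz w] by blast
  have dL: "deriv L u = deriv f u / f u" if "u \<in> D" for u
    by (rule deriv_holomorphic_log[OF L(1) D(1) L(2) nz that])
  have "cmod (L z - L w) \<le> 12 * pi / d * cmod (z - w)"
  proof (rule field_differentiable_bound[of "closed_segment w z"])
    fix u assume u: "u \<in> closed_segment w z"
    then have uD: "u \<in> D" using sub by auto
    show "(L has_field_derivative deriv L u) (at u within closed_segment w z)"
      using L(1) uD holomorphic_derivI D has_field_derivative_at_within by blast
    have "d * cmod (deriv f u / f u) \<le> 12 * pi"
    proof (rule univalent_log_deriv_bound[OF _ _ _ d])
      show "f holomorphic_on ball u d" using hol seg[OF u] holomorphic_on_subset by blast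
      show "inj_on f (ball u d)" using inj seg[OF u] inj_on_subset by blast
      show "\<And>z. z \<in> ball u d \<Longrightarrow> f z \<noteq> 0" using nz seg[OF u] by blast
    qed
    then show "cmod (deriv L u) \<le> 12 * pi / d"
      using d by (simp add: dL[OF uD] field_simps)
  qed auto
  moreover have "Re (L z) - Re (L w) \<le> cmod (L z - L w)"
    using complex_Re_le_cmod[of "L z - L w"] by simp
  ultimately have "Re (L z) \<le> Re (L w) + 12 * pi / d * cmod (z - w)" by linarith
  then have "exp (Re (L z)) \<le> exp (Re (L w)) * exp (12 * pi / d * cmod (z - w))"
    by (simp add: exp_add[symmetric])
  moreover have "cmod (f u) = exp (Re (L u))" if "u \<in> D" for u
    by (simp flip: L(2)[OF that])
  ultimately show ?thesis using w z by simp
qed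

section \<open>Integrating a power asymptotic up to the endpoint\<close>

text \<open>Removing the explicit primitive of b (1 - r)^(-\<alpha>) leaves a function
  \<open>v\<close> whose derivative is o((1 - r)^(-\<alpha>)). As \<alpha> < 1, its increments are
  o((1 - r)^(1 - \<alpha>)), which yields at once the Cauchy property and the rate. The mean value
  inequality takes the place of l'Hospital's rule, since the values are complex.\<close>

lemma asymptotic_integration:
  fixes u u' :: "real \<Rightarrow> complex" and b :: complex
  assumes r0: "r0 < 1" and \<alpha>: "\<alpha> < 1"
    and der: "\<And>r. r0 < r \<Longrightarrow> r < 1 \<Longrightarrow> (u has_vector_derivative u' r) (at r)"
    and lim: "((\<lambda>r. u' r * of_real ((1 - r) powr \<alpha>)) \<longlongrightarrow> b) (at_left 1)"
  obtains l where "(u \<longlongrightarrow> l) (at_left 1)"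
    "((\<lambda>r. (l - u r) / of_real ((1 - r) powr (1 - \<alpha>))) \<longlongrightarrow> b / of_real (1 - \<alpha>)) (at_left 1)"
proof -
  define \<beta> where "\<beta> = 1 - \<alpha>"
  have \<beta>: "\<beta> > 0" using \<alpha> by (simp add: \<beta>_def)
  define p where "p r = (1 - r) powr \<beta>" for r :: real
  define v where "v r = u r + b / of_real \<beta> * of_real (p r)" for r
  have dp: "(p has_real_derivative - \<beta> * (1 - r) powr (- \<alpha>)) (at r)" if "r < 1" for r
    unfolding p_def using that
    by (auto intro!: derivative_eq_intros simp: \<beta>_def algebra_simps)
  have dpc: "((\<lambda>r. of_real (p r) :: complex) has_vector_derivative of_real (- \<beta> * (1 - r) powr (- \<alpha>))) (at r)"
    if "r < 1" for r
    using dp[OF that] has_vector_derivative_of_real by blast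
  have dv: "(v has_vector_derivative u' r - b * of_real ((1 - r) powr (- \<alpha>))) (at r)"
    if "r0 < r" "r < 1" for r
  proof -
    have "((\<lambda>r. u r + b / of_real \<beta> * of_real (p r)) has_vector_derivative
        u' r + b / of_real \<beta> * of_real (- \<beta> * (1 - r) powr (- \<alpha>))) (at r)"
      using that by (intro has_vector_derivative_add has_vector_derivative_mult_right der dpc)
    then show ?thesis using \<beta> by (simp add: v_def[abs_def])
  qed
  have p0: "(p \<longlongrightarrow> 0) (at_left 1)"
    unfolding p_def using \<beta>
    by (auto intro!: tendsto_eq_intros simp: eventually_at_left_field intro: lt_ex)
  have ppos: "p r > 0" if "r < 1" for r using that by (simp add: p_def)
  have key: "\<exists>r1<1. r0 < r1 \<and> (\<forall>r s. r1 < r \<and> r < s \<and> s < 1 \<longrightarrow> cmod (v s - v r) \<le> e * p r)" if e: "e > 0" for e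
  proof -
    have "\<forall>\<^sub>F r in at_left 1. dist (u' r * of_real ((1 - r) powr \<alpha>)) b < e * \<beta>"
      using tendstoD[OF lim] e \<beta> by simp
    then obtain r2 where r2: "r2 < 1"
      "\<And>r. r2 < r \<Longrightarrow> r < 1 \<Longrightarrow> dist (u' r * of_real ((1 - r) powr \<alpha>)) b < e * \<beta>"
      by (auto simp: eventually_at_left_field)
    have "cmod (v s - v r) \<le> e * p r" if rs: "max r0 r2 < r" "r < s" "s < 1" for r s
    proof -
      \<comment> \<open>The majorant \<open>- e * p\<close> has derivative exactly e \<beta> (1 -
        t)^(-\<alpha>), which dominates the norm of v'. It increases to 0, so its increment over
        [r, s] is at most e p(r), whatever s is.\<close>
      have "cmod (v s - v r) \<le> (- e * p s) - (- e * p r)"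
      proof (rule differentiable_bound_general[of r s v "\<lambda>r. - e * p r"])
        show "r < s" by fact
        show "continuous_on {r..s} v"
        proof (intro continuous_at_imp_continuous_on ballI)
          fix t assume "t \<in> {r..s}"
          then show "isCont v t" using dv[of t] rs by (auto intro: has_vector_derivative_continuous)
        qed
        show "continuous_on {r..s} (\<lambda>r. - e * p r)"
        proof (intro continuous_at_imp_continuous_on ballI)
          fix t assume "t \<in> {r..s}"
          then have "isCont p t" using dp[of t] rs by (auto intro: DERIV_isCont)
          then show "isCont (\<lambda>r. - e * p r) t" by (intro continuous_intros)
        qed
        fix t assume t: "r < t" "t < s"
        show "(v has_vector_derivative u' t - b * of_real ((1 - t) powr (- \<alpha>))) (at t)"
          using t rs by (intro dv) auto
        show "((\<lambda>r. - e * p r) has_vector_derivative - e * (- \<beta> * (1 - t) powr (- \<alpha>))) (at t)"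
          using dp[of t] t rs
          by (auto intro!: derivative_eq_intros simp flip: has_real_derivative_iff_has_vector_derivative)
        have "u' t - b * of_real ((1 - t) powr (- \<alpha>))
            = (u' t * of_real ((1 - t) powr \<alpha>) - b) * of_real ((1 - t) powr (- \<alpha>))"
        proof -
          have "(1 - t) powr \<alpha> * (1 - t) powr (- \<alpha>) = 1"
            using t rs by (simp flip: powr_add)
          then have "complex_of_real ((1 - t) powr \<alpha>) * of_real ((1 - t) powr (- \<alpha>)) = 1"
            by (metis of_real_1 of_real_mult)
          then show ?thesis by (simp add: algebra_simps)
        qed
        also have "cmod \<dots> \<le> e * \<beta> * (1 - t) powr (- \<alpha>)"
          using r2(2)[of t] t rs by (auto simp: norm_mult dist_norm intro!: mult_right_mono)
        finally show "cmod (u' t - b * of_real ((1 - t) powr (- \<alpha>))) \<le> - e * (- \<beta> * (1 - t) powr (- \<alpha>))"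
          by simp
      qed
      also have "\<dots> \<le> e * p r" using ppos[of s] rs e by simp
      finally show ?thesis .
    qed
    \<comment> \<open>The midpoints with 1 lie strictly above \<open>r0\<close> and
      \<open>r2\<close> and still below 1.\<close>
    then show ?thesis using r0 r2(1)
      by (intro exI[of _ "max ((r0+1)/2) ((r2+1)/2)"]) (auto simp: less_max_iff_disj)
  qed
  have "\<exists>l. (v \<longlongrightarrow> l) (at_left 1)"
  proof -
    have "cauchy_filter (filtermap v (at_left 1))"
      unfolding cauchy_filter_metric_filtermap
    proof safe
      fix e :: real assume e: "e > 0"
      obtain r1 where r1: "r1 < 1" "\<And>r s. r1 < r \<Longrightarrow> r < s \<Longrightarrow> s < 1 \<Longrightarrow> cmod (v s - v r) \<le> (e/2) * p r"
        using key[OF half_gt_zero[OF e]] by metis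
      have "\<forall>\<^sub>F r in at_left 1. p r < 1" using p0 order_tendstoD(2) zero_less_one by blast
      then obtain r3 where r3: "r3 < 1" "\<And>r. r3 < r \<Longrightarrow> r < 1 \<Longrightarrow> p r < 1"
        by (auto simp: eventually_at_left_field)
      have *: "cmod (v s - v r) < e" if "max r1 r3 < r" "r < s" "s < 1" for r s
      proof -
        have "(e/2) * p r \<le> (e/2) * 1" using r3(2)[of r] that e by (intro mult_left_mono) auto
        moreover have "cmod (v s - v r) \<le> (e/2) * p r" using r1(2)[of r s] that by simp
        ultimately show ?thesis using e by linarith
      qed
      have "dist (v r) (v s) < e" if "max r1 r3 < r \<and> r < 1" "max r1 r3 < s \<and> s < 1" for r s
      proof (cases r s rule: linorder_cases)
        case less
        then show ?thesis using *[of r s] that by (simp add: dist_norm norm_minus_commute)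
      next
        case equal
        then show ?thesis using e by simp
      next
        case greater
        then show ?thesis using *[of s r] that by (simp add: dist_norm)
      qed
      moreover have "\<forall>\<^sub>F r in at_left 1. max r1 r3 < r \<and> r < (1::real)"
        unfolding eventually_at_left_field using r1(1) r3(1) by (intro exI[of _ "max r1 r3"]) auto
      ultimately show "\<exists>P. eventually P (at_left 1) \<and> (\<forall>x y. P x \<and> P y \<longrightarrow> dist (v x) (v y) < e)"
        by blast
    qed
    moreover have "filtermap v (at_left 1) \<noteq> bot" by (simp add: filtermap_bot_iff)
    ultimately show ?thesis
      using complete_UNIV[where 'a=complex] unfolding complete_uniform filterlim_def by auto
  qed
  then obtain l where l: "(v \<longlongrightarrow> l) (at_left 1)" by blast
  have "((\<lambda>r. v r - b / of_real \<beta> * of_real (p r)) \<longlongrightarrow> l - b / of_real \<beta> * of_real 0) (at_left 1)"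
    by (intro tendsto_intros l p0)
  then have ul: "(u \<longlongrightarrow> l) (at_left 1)" by (simp add: v_def)
  have "((\<lambda>r. (l - v r) / of_real (p r)) \<longlongrightarrow> 0) (at_left 1)"
  proof (rule tendstoI)
    fix e :: real assume e: "e > 0"
    obtain r1 where r1: "r1 < 1" "\<And>r s. r1 < r \<Longrightarrow> r < s \<Longrightarrow> s < 1 \<Longrightarrow> cmod (v s - v r) \<le> (e/2) * p r"
      using key[OF half_gt_zero[OF e]] by metis
    have "dist ((l - v r) / of_real (p r)) 0 < e" if r: "r1 < r" "r < 1" for r
    proof -
      have "((\<lambda>s. cmod (v s - v r)) \<longlongrightarrow> cmod (l - v r)) (at_left 1)" by (intro tendsto_intros l)
      moreover have "\<forall>\<^sub>F s in at_left 1. cmod (v s - v r) \<le> (e/2) * p r"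
        unfolding eventually_at_left_field using r r1(2) by (intro exI[of _ r]) auto
      ultimately have "cmod (l - v r) \<le> (e/2) * p r"
        by (rule tendsto_upperbound) (rule trivial_limit_at_left_real)
      also have "\<dots> < e * p r" using e ppos[OF r(2)] by simp
      finally show ?thesis using ppos[OF r(2)] by (simp add: norm_divide divide_less_eq)
    qed
    then show "\<forall>\<^sub>F r in at_left 1. dist ((l - v r) / of_real (p r)) 0 < e"
      unfolding eventually_at_left_field using r1(1) by blast
  qed
  then have "((\<lambda>r. (l - v r) / of_real (p r) + b / of_real \<beta>) \<longlongrightarrow> 0 + b / of_real \<beta>) (at_left 1)"
    by (intro tendsto_intros)
  then have "((\<lambda>r. (l - v r) / of_real (p r) + b / of_real \<beta>) \<longlongrightarrow> b / of_real \<beta>) (at_left 1)"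
    by simp
  then have "((\<lambda>r. (l - u r) / of_real (p r)) \<longlongrightarrow> b / of_real \<beta>) (at_left 1)"
  proof (rule Lim_transform_eventually)
    have "(l - v r) / of_real (p r) + b / of_real \<beta> = (l - u r) / of_real (p r)" if "r < 1" for r
      using ppos[OF that] by (simp add: v_def field_simps)
    then show "\<forall>\<^sub>F r in at_left 1. (l - v r) / of_real (p r) + b / of_real \<beta> = (l - u r) / of_real (p r)"
      unfolding eventually_at_left_field by (intro exI[of _ 0]) auto
  qed
  with ul show ?thesis by (intro that[of l]) (auto simp: p_def \<beta>_def)
qed

section \<open>From the generator to the radial behaviour of the Koenigs function\<close>

text \<open>The value of \<open>h\<close> along the orbit enters as an abstract function
  \<open>E\<close> of time, so that the translation h + t and the dilation exp(\<mu> t) h are both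
  covered. The derivative at time 0 is one-sided, and still unique.\<close>

lemma generator_equation:
  assumes sg: "one_param_semigroup \<phi>" and gen: "is_generator \<phi> G"
    and hol: "h holomorphic_on unit_disc" and z: "z \<in> unit_disc"
    and E: "\<And>t. t \<ge> 0 \<Longrightarrow> h (\<phi> t z) = E t"
    and E': "(E has_vector_derivative e) (at 0 within {0..})"
  shows "deriv h z * G z = e"
proof -
  have \<phi>0: "\<phi> 0 z = z" using sg z by (simp add: one_param_semigroup_def)
  have "((\<lambda>t. \<phi> t z) has_vector_derivative G (\<phi> 0 z)) (at 0 within {0..})"
    using gen z by (simp add: is_generator_def)
  moreover have "(h has_field_derivative deriv h z) (at (\<phi> 0 z) within (\<lambda>t. \<phi> t z) ` {0..})"
    using holomorphic_derivI[OF hol _ z] by (simp add: \<phi>0 unit_disc_def)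
  ultimately have "(h \<circ> (\<lambda>t. \<phi> t z) has_vector_derivative G (\<phi> 0 z) * deriv h z) (at 0 within {0..})"
    by (rule field_vector_diff_chain_within)
  then have "(E has_vector_derivative G z * deriv h z) (at 0 within {0..})"
    using has_vector_derivative_transform[of 0 "{0..}" E "h \<circ> (\<lambda>t. \<phi> t z)"] by (simp add: E \<phi>0)
  moreover have "at 0 within {0..} \<noteq> (bot :: real filter)"
    using trivial_limit_at_right_real[of "0::real"]
    by (metis at_within_Ici_at_right)
  ultimately show ?thesis
    using vector_derivative_unique_within[OF _ _ E'] by (simp add: mult.commute)
qed

lemma eventually_at_left_1I:
  assumes "\<And>r::real. 0 < r \<Longrightarrow> r < 1 \<Longrightarrow> P r"
  shows "\<forall>\<^sub>F r in at_left 1. P r"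
  unfolding eventually_at_left_field using assms by (intro exI[of _ 0]) auto

lemma radius_in_disc:
  assumes "cmod x = 1" "0 < r" "r < 1"
  shows "of_real r * x \<in> unit_disc"
  using assms by (simp add: unit_disc_def norm_mult)

lemma radial_has_vector_derivative:
  assumes "h holomorphic_on S" "open S" "of_real r * x \<in> S"
  shows "((\<lambda>r. h (of_real r * x)) has_vector_derivative x * deriv h (of_real r * x)) (at r)"
proof -
  have "((\<lambda>r. of_real r * x) has_vector_derivative 1 * x) (at r)"
    by (auto intro!: derivative_eq_intros)
  then have "((\<lambda>r. of_real r * x) has_vector_derivative x) (at r)" by simp
  from field_vector_diff_chain_at[OF this, of h "deriv h (of_real r * x)"]
  show ?thesis using holomorphic_derivI[OF assms(1,2,3)] by (simp add: o_def)
qed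

lemma koenigs_radial_asymptotics:
  assumes sg: "one_param_semigroup \<phi>" and gen: "is_generator \<phi> G"
    and koe: "koenigs_function \<phi> G \<tau> h" and x: "cmod x = 1" and \<alpha>: "\<alpha> < 1"
    and reg: "regular_singularity G x \<alpha>"
  obtains hx C where "C \<noteq> 0" "((\<lambda>r. h (of_real r * x)) \<longlongrightarrow> hx) (at_left 1)"
    "((\<lambda>r. (hx - h (of_real r * x)) / of_real ((1 - r) powr (1 - \<alpha>))) \<longlongrightarrow> C) (at_left 1)"
proof -
  have hol: "h holomorphic_on unit_disc" and inj: "inj_on h unit_disc"
    using koe by (auto simp: koenigs_function_def)
  have op: "open unit_disc" by (simp add: unit_disc_def)
  obtain c where c: "c \<noteq> 0" and limG: "((\<lambda>r. G (of_real r * x) / of_real ((1 - r) powr \<alpha>)) \<longlongrightarrow> c) (at_left 1)"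
    using reg by (auto simp: regular_singularity_def)
  from tendsto_inverse[OF limG c]
  have inv: "((\<lambda>r. of_real ((1 - r) powr \<alpha>) / G (of_real r * x)) \<longlongrightarrow> 1 / c) (at_left 1)"
    by (simp add: field_simps)
  have Gnz: "\<forall>\<^sub>F r in at_left 1. G (of_real r * x) \<noteq> 0"
    using tendsto_imp_eventually_ne[OF limG c] by eventually_elim auto
  have "\<exists>b. b \<noteq> 0 \<and> ((\<lambda>r. deriv h (of_real r * x) * of_real ((1 - r) powr \<alpha>)) \<longlongrightarrow> b) (at_left 1)"
  proof (cases "\<tau> \<in> unit_disc")
    case False
    have ode: "deriv h z * G z = 1" if "z \<in> unit_disc" for z
    proof (rule generator_equation[OF sg gen hol that])
      show "h (\<phi> t z) = h z + of_real t" if "t \<ge> 0" for t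
        using koe False \<open>z \<in> unit_disc\<close> that by (simp add: koenigs_function_def)
      show "((\<lambda>t. h z + complex_of_real t) has_vector_derivative 1) (at 0 within {0..})"
        by (auto intro!: derivative_eq_intros)
    qed
    have "deriv h (of_real r * x) * of_real ((1 - r) powr \<alpha>) = of_real ((1 - r) powr \<alpha>) / G (of_real r * x)"
      if "0 < r" "r < 1" for r
    proof -
      from ode[OF radius_in_disc[OF x that]]
      have "deriv h (of_real r * x) = 1 / G (of_real r * x)"
        by (metis mult_zero_right nonzero_eq_divide_eq zero_neq_one)
      then show ?thesis by simp
    qed
    from inv eventually_at_left_1I[OF this[symmetric]]
    have "((\<lambda>r. deriv h (of_real r * x) * of_real ((1 - r) powr \<alpha>)) \<longlongrightarrow> 1 / c) (at_left 1)"
      by (rule Lim_transform_eventually)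
    then show ?thesis using c by (intro exI[of _ "1 / c"]) simp
  next
    case True
    define \<mu> where "\<mu> = deriv G \<tau>"
    have eq: "h (\<phi> t z) = exp (\<mu> * of_real t) * h z" if "t \<ge> 0" "z \<in> unit_disc" for t z
      using koe True that by (simp add: koenigs_function_def \<mu>_def)
    have h\<tau>: "h \<tau> = 0" using koe True by (simp add: koenigs_function_def)
    \<comment> \<open>Needed for a nonzero leading coefficient. With \<mu> = 0, \<open>h\<close>
      would be invariant under \<open>\<phi> 1\<close>, and its injectivity would make
      \<open>\<phi> 1\<close> the identity, an automorphism.\<close>
    have \<mu>: "\<mu> \<noteq> 0"
    proof
      assume "\<mu> = 0"
      then have "\<phi> 1 z = z" if "z \<in> unit_disc" for z
        using eq[of 1 z] that inj_onD[OF inj, of "\<phi> 1 z" z] sg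
        by (auto simp: one_param_semigroup_def image_subset_iff)
      then have "bij_betw (\<phi> 1) unit_disc unit_disc"
        using bij_betw_cong[of unit_disc "\<phi> 1" id unit_disc] by simp
      then show False using sg by (simp add: one_param_semigroup_def)
    qed
    have ode: "deriv h z * G z = \<mu> * h z" if "z \<in> unit_disc" for z
    proof (rule generator_equation[OF sg gen hol that])
      show "h (\<phi> t z) = exp (\<mu> * of_real t) * h z" if "t \<ge> 0" for t
        using eq \<open>z \<in> unit_disc\<close> that by simp
      have "((\<lambda>w. exp (\<mu> * w) * h z) has_field_derivative \<mu> * h z) (at (of_real 0) within of_real ` {0..})"
        by (auto intro!: derivative_eq_intros)
      moreover have "(complex_of_real has_vector_derivative 1) (at 0 within {0..})"
        by (auto intro!: derivative_eq_intros)
      ultimately show "((\<lambda>t. exp (\<mu> * of_real t) * h z) has_vector_derivative \<mu> * h z) (at 0 within {0..})"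
        using field_vector_diff_chain_within[of complex_of_real 1 0 "{0..}"
            "\<lambda>w. exp (\<mu> * w) * h z" "\<mu> * h z"] by (simp add: o_def)
    qed
    \<comment> \<open>The ball of this radius about x just excludes \<tau>, the only zero of
      \<open>h\<close>. Its intersection \<open>W\<close> with the disc is convex and contains the
      end of the radius, so log h exists there.\<close>
    define \<epsilon> where "\<epsilon> = cmod (x - \<tau>)"
    define W where "W = ball x \<epsilon> \<inter> unit_disc"
    have \<epsilon>: "\<epsilon> > 0" using True x by (auto simp: \<epsilon>_def unit_disc_def)
    have W: "convex W" "open W" by (auto simp: W_def unit_disc_def intro!: convex_Int)
    have inW: "of_real r * x \<in> W" if "max 0 (1 - \<epsilon>) < r" "r < 1" for r
    proof -
      have "x - of_real r * x = of_real (1 - r) * x" by (simp add: algebra_simps)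
      then have "dist x (of_real r * x) = 1 - r"
        using that x by (simp add: dist_norm norm_mult del: of_real_diff)
      then show ?thesis using that radius_in_disc[OF x, of r] by (simp add: W_def)
    qed
    have nzW: "h z \<noteq> 0" if "z \<in> W" for z
      using that inj_onD[OF inj, of z \<tau>] True h\<tau> by (auto simp: W_def \<epsilon>_def dist_norm)
    have evW: "\<forall>\<^sub>F r in at_left 1. of_real r * x \<in> W"
      unfolding eventually_at_left_field using inW \<epsilon> by (intro exI[of _ "max 0 (1 - \<epsilon>)"]) auto
    obtain z0 where z0: "z0 \<in> W"
      using eventually_happens'[OF trivial_limit_at_left_real evW] by blast
    obtain L where L: "L holomorphic_on W" "\<And>z. z \<in> W \<Longrightarrow> exp (L z) = h z"
      using holomorphic_logarithm_exists[OF W holomorphic_on_subset[OF hol] nzW z0]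
      by (auto simp: W_def)
    have dL: "deriv L z = deriv h z / h z" if "z \<in> W" for z
      by (rule deriv_holomorphic_log[OF L(1) W(2) L(2) nzW that])
    \<comment> \<open>This first integration, applied to L = log h, serves only to show that L
      converges; hence h(rx) tends to exp(l), which cannot be 0. The rate comes from a second
      integration, applied to \<open>h\<close> itself after the case distinction.\<close>
    have "((\<lambda>r. x * deriv L (of_real r * x) * of_real ((1 - r) powr \<alpha>)) \<longlongrightarrow> x * (\<mu> * (1 / c))) (at_left 1)"
    proof (rule Lim_transform_eventually)
      show "((\<lambda>r. x * (\<mu> * (of_real ((1 - r) powr \<alpha>) / G (of_real r * x)))) \<longlongrightarrow> x * (\<mu> * (1 / c))) (at_left 1)"
        by (intro tendsto_intros inv)
      show "\<forall>\<^sub>F r in at_left 1. x * (\<mu> * (of_real ((1 - r) powr \<alpha>) / G (of_real r * x)))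
          = x * deriv L (of_real r * x) * of_real ((1 - r) powr \<alpha>)"
        using evW Gnz
      proof eventually_elim
        case (elim r)
        have "deriv h (of_real r * x) = \<mu> * h (of_real r * x) / G (of_real r * x)"
          using ode[of "of_real r * x"] elim by (simp add: W_def nonzero_eq_divide_eq)
        then have "deriv L (of_real r * x) = \<mu> / G (of_real r * x)"
          using nzW[OF elim(1)] dL[OF elim(1)] by simp
        then show ?case by simp
      qed
    qed
    moreover have "((\<lambda>r. L (of_real r * x)) has_vector_derivative x * deriv L (of_real r * x)) (at r)"
      if "max 0 (1 - \<epsilon>) < r" "r < 1" for r
      using radial_has_vector_derivative[OF L(1) W(2) inW[OF that]] .
    moreover have "max 0 (1 - \<epsilon>) < 1" using \<epsilon> by simp
    ultimately obtain l where "((\<lambda>r. L (of_real r * x)) \<longlongrightarrow> l) (at_left 1)"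
      using asymptotic_integration[OF _ \<alpha>, of _ "\<lambda>r. L (of_real r * x)" "\<lambda>r. x * deriv L (of_real r * x)"]
      by blast
    from tendsto_exp[OF this]
    have hl: "((\<lambda>r. h (of_real r * x)) \<longlongrightarrow> exp l) (at_left 1)"
      by (rule Lim_transform_eventually) (use evW L(2) in \<open>auto elim: eventually_mono\<close>)
    have "((\<lambda>r. deriv h (of_real r * x) * of_real ((1 - r) powr \<alpha>)) \<longlongrightarrow> \<mu> * exp l * (1 / c)) (at_left 1)"
    proof (rule Lim_transform_eventually)
      show "((\<lambda>r. \<mu> * h (of_real r * x) * (of_real ((1 - r) powr \<alpha>) / G (of_real r * x))) \<longlongrightarrow> \<mu> * exp l * (1 / c)) (at_left 1)"
        by (intro tendsto_intros inv hl)
      show "\<forall>\<^sub>F r in at_left 1. \<mu> * h (of_real r * x) * (of_real ((1 - r) powr \<alpha>) / G (of_real r * x))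
          = deriv h (of_real r * x) * of_real ((1 - r) powr \<alpha>)"
        using evW Gnz
      proof eventually_elim
        case (elim r)
        then show ?case
          using ode[of "of_real r * x"] by (simp add: W_def field_simps)
      qed
    qed
    then show ?thesis using c \<mu> by (intro exI[of _ "\<mu> * exp l * (1 / c)"]) simp
  qed
  then obtain b where b: "b \<noteq> 0"
    and limb: "((\<lambda>r. deriv h (of_real r * x) * of_real ((1 - r) powr \<alpha>)) \<longlongrightarrow> b) (at_left 1)"
    by blast
  have "((\<lambda>r. x * deriv h (of_real r * x) * of_real ((1 - r) powr \<alpha>)) \<longlongrightarrow> x * b) (at_left 1)"
    using tendsto_mult_left[OF limb, of x] by (simp add: mult.assoc)
  moreover have "((\<lambda>r. h (of_real r * x)) has_vector_derivative x * deriv h (of_real r * x)) (at r)"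
    if "0 < r" "r < 1" for r
    using radial_has_vector_derivative[OF hol op radius_in_disc[OF x that]] .
  ultimately obtain hx where "((\<lambda>r. h (of_real r * x)) \<longlongrightarrow> hx) (at_left 1)"
     "((\<lambda>r. (hx - h (of_real r * x)) / of_real ((1 - r) powr (1 - \<alpha>))) \<longlongrightarrow> x * b / of_real (1 - \<alpha>)) (at_left 1)"
    using asymptotic_integration[OF zero_less_one \<alpha>, of "\<lambda>r. h (of_real r * x)" "\<lambda>r. x * deriv h (of_real r * x)"]
    by blast
  moreover have "x * b / of_real (1 - \<alpha>) \<noteq> 0" using b x \<alpha> by auto
  ultimately show ?thesis using that by blast
qed

section \<open>The boundary value and the angular limit\<close>

text \<open>The inverse of \<open>h\<close> is continuous on the open image, so an attained value
  h(z0) would force rx to converge to z0 inside the disc instead of x. This makes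
  \<open>hx - h\<close> zero-free and gives it a logarithm on the disc.\<close>

lemma boundary_value_not_attained:
  assumes hol: "h holomorphic_on unit_disc" and inj: "inj_on h unit_disc" and x: "cmod x = 1"
    and lim: "((\<lambda>r. h (of_real r * x)) \<longlongrightarrow> hx) (at_left 1)"
  shows "hx \<notin> h ` unit_disc"
proof
  assume "hx \<in> h ` unit_disc"
  then obtain z0 where z0: "z0 \<in> unit_disc" "hx = h z0" by blast
  have op: "open unit_disc" by (simp add: unit_disc_def)
  obtain g where g: "g holomorphic_on h ` unit_disc" "\<And>z. z \<in> unit_disc \<Longrightarrow> g (h z) = z"
    using holomorphic_has_inverse[OF hol op inj] by metis
  have "isCont g hx"
    using g(1) z0 open_mapping_thm3[OF hol op inj]
    by (meson continuous_on_eq_continuous_at holomorphic_on_imp_continuous_on image_eqI)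
  from isCont_tendsto_compose[OF this lim]
  have "((\<lambda>r. g (h (of_real r * x))) \<longlongrightarrow> z0) (at_left 1)" using g(2) z0 by simp
  moreover have "\<forall>\<^sub>F r in at_left 1. g (h (of_real r * x)) = of_real r * x"
    using g(2) radius_in_disc[OF x] by (intro eventually_at_left_1I) auto
  ultimately have "((\<lambda>r. of_real r * x) \<longlongrightarrow> z0) (at_left 1)"
    by (rule Lim_transform_eventually)
  moreover have "((\<lambda>r. of_real r * x) \<longlongrightarrow> of_real 1 * x) (at_left 1)"
    by (intro tendsto_intros)
  ultimately have "z0 = x" using tendsto_unique[OF trivial_limit_at_left_real] by fastforce
  then show False using z0 x by (simp add: unit_disc_def)
qed

lemma radial_limit_zero:
  fixes f :: "complex \<Rightarrow> complex"
  assumes \<beta>: "\<beta> > 0"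
    and lim: "((\<lambda>r. f (of_real r * x) / of_real ((1 - r) powr \<beta>)) \<longlongrightarrow> C) (at_left 1)"
  shows "((\<lambda>r. f (of_real r * x)) \<longlongrightarrow> 0) (at_left 1)"
proof -
  have "((\<lambda>r::real. (1 - r) powr \<beta>) \<longlongrightarrow> 0) (at_left 1)"
    using \<beta> by (auto intro!: tendsto_eq_intros eventually_at_left_1I)
  then have "((\<lambda>r. f (of_real r * x) / of_real ((1 - r) powr \<beta>) * of_real ((1 - r) powr \<beta>)) \<longlongrightarrow> C * of_real 0) (at_left 1)"
    by (intro tendsto_intros lim)
  then have "((\<lambda>r. f (of_real r * x) / of_real ((1 - r) powr \<beta>) * of_real ((1 - r) powr \<beta>)) \<longlongrightarrow> 0) (at_left 1)"
    by simp
  then show ?thesis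
    by (rule Lim_transform_eventually) (rule eventually_at_left_1I, simp)
qed

text \<open>In a Stolz angle, z is compared with the radial point of the same modulus: the growth
  bound costs a factor that depends on the opening K only.\<close>

lemma univalent_angular_limit_zero:
  assumes hol: "f holomorphic_on unit_disc" and inj: "inj_on f unit_disc"
    and nz: "\<And>z. z \<in> unit_disc \<Longrightarrow> f z \<noteq> 0" and x: "cmod x = 1"
    and lim: "((\<lambda>r. f (of_real r * x)) \<longlongrightarrow> 0) (at_left 1)"
  shows "angular_limit f x 0"
  unfolding angular_limit_def
proof (intro allI impI)
  fix K :: real assume "K > 1"
  define S where "S = {z \<in> unit_disc. cmod (x - z) < K * (1 - cmod z)}"
  have bound: "cmod (f z) \<le> cmod (f (of_real (cmod z) * x)) * exp (12 * pi * (K + 1))" if z: "z \<in> S" for z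
  proof -
    define d where "d = 1 - cmod z"
    have d: "d > 0" using z by (simp add: S_def d_def unit_disc_def)
    have "cmod (f z) \<le> cmod (f (of_real (cmod z) * x)) * exp (12 * pi / d * cmod (z - of_real (cmod z) * x))"
    proof (rule univalent_growth_bound[OF hol inj _ _ nz d])
      fix u assume "u \<in> closed_segment (of_real (cmod z) * x) z"
      moreover have "closed_segment (of_real (cmod z) * x) z \<subseteq> cball 0 (cmod z)"
        by (intro closed_segment_subset) (auto simp: norm_mult x)
      ultimately have u: "cmod u \<le> cmod z" by auto
      show "ball u d \<subseteq> unit_disc"
      proof
        fix v assume "v \<in> ball u d"
        then have "cmod (v - u) < d" by (simp add: dist_norm norm_minus_commute)
        then show "v \<in> unit_disc"
          using norm_triangle_ineq[of u "v - u"] u by (simp add: unit_disc_def d_def)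
      qed
    qed (auto simp: unit_disc_def)
    \<comment> \<open>The length of the segment is at most |z - x| + |x - |z| x|, that is K d + d,
      so the quotient by d is at most K + 1.\<close>
    also have "\<dots> \<le> cmod (f (of_real (cmod z) * x)) * exp (12 * pi * (K + 1))"
    proof -
      have "x - of_real (cmod z) * x = of_real d * x" by (simp add: d_def algebra_simps)
      then have "cmod (x - of_real (cmod z) * x) = d" using x d by (simp add: norm_mult)
      then have "cmod (z - of_real (cmod z) * x) \<le> cmod (x - z) + d"
        using norm_triangle_ineq[of "z - x" "x - of_real (cmod z) * x"] by (simp add: norm_minus_commute)
      also have "\<dots> \<le> (K + 1) * d" using z by (simp add: S_def d_def algebra_simps)
      finally have "cmod (z - of_real (cmod z) * x) \<le> (K + 1) * d" .
      then have "12 * pi / d * cmod (z - of_real (cmod z) * x) \<le> 12 * pi / d * ((K + 1) * d)"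
        using d by (intro mult_left_mono) auto
      then show ?thesis using d by (intro mult_left_mono) auto
    qed
    finally show ?thesis .
  qed
  have "filterlim cmod (at_left 1) (at x within S)"
    unfolding filterlim_at
  proof (intro conjI)
    show "(cmod \<longlongrightarrow> 1) (at x within S)"
      using tendsto_norm[OF tendsto_ident_at[of x S]] x by simp
    show "\<forall>\<^sub>F z in at x within S. cmod z \<in> {..<1} \<and> cmod z \<noteq> 1"
      by (auto simp: eventually_at_filter S_def unit_disc_def)
  qed
  from filterlim_compose[OF lim this]
  have "((\<lambda>z. cmod (f (of_real (cmod z) * x)) * exp (12 * pi * (K + 1))) \<longlongrightarrow> 0) (at x within S)"
    by (intro tendsto_mult_left_zero tendsto_norm_zero)
  then show "(f \<longlongrightarrow> 0) (at x within {z \<in> unit_disc. cmod (x - z) < K * (1 - cmod z)})"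
    unfolding S_def[symmetric]
    by (rule Lim_null_comparison[rotated]) (use bound in \<open>auto simp: eventually_at_filter\<close>)
qed

section \<open>Rescaling at the boundary point and sectors inside the image\<close>

lemma ball_tangent_imaginary_axis:
  assumes "z \<in> ball (complex_of_real R) R"
  shows "Re z > 0"
proof -
  have "R - Re z \<le> cmod (of_real R - z)" using complex_Re_le_cmod[of "of_real R - z"] by simp
  then show ?thesis using assms by (simp add: dist_norm)
qed

lemma scaled_ball_in_disc:
  fixes \<zeta> :: complex
  assumes x: "cmod x = 1" and t: "t > 0" "t * R \<le> 1" and \<zeta>: "\<zeta> \<in> ball (of_real R) R"
  shows "x * (1 - of_real t * \<zeta>) \<in> unit_disc"
proof -
  have "1 - of_real t * \<zeta> = of_real (1 - t * R) + of_real t * (of_real R - \<zeta>)"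
    by (simp add: algebra_simps)
  then have "cmod (1 - of_real t * \<zeta>) \<le> (1 - t * R) + t * cmod (of_real R - \<zeta>)"
    using norm_triangle_ineq[of "of_real (1 - t * R)" "of_real t * (of_real R - \<zeta>)"] t
    by (simp add: norm_mult del: of_real_diff)
  also have "\<dots> < (1 - t * R) + t * R"
    using \<zeta> t by (simp add: dist_norm)
  finally show ?thesis using x by (simp add: unit_disc_def norm_mult)
qed

text \<open>Rescaling at the boundary point \<open>x\<close>: the discs tangent to the imaginary axis at 0 exhaust the
  right half-plane, and the radial asymptotics determine every Montel limit on the positive axis.\<close>

lemma univalent_scaling_limit:
  fixes r :: "nat \<Rightarrow> real"
  assumes hol: "f holomorphic_on unit_disc" and inj: "inj_on f unit_disc"
    and nz: "\<And>z. z \<in> unit_disc \<Longrightarrow> f z \<noteq> 0" and x: "cmod x = 1"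
    and C: "C \<noteq> 0"
    and lim: "((\<lambda>r. f (of_real r * x) / of_real ((1 - r) powr \<beta>)) \<longlongrightarrow> C) (at_left 1)"
    and R: "R > 0" and r: "\<And>n. r n > 0" "\<And>n. r n * R \<le> 1" "r \<longlonglongrightarrow> 0"
  defines "F \<equiv> \<lambda>n \<zeta>. f (x * (1 - of_real (r n) * \<zeta>)) / (C * of_real (r n powr \<beta>))"
  obtains s where "strict_mono s" "\<And>n. F n holomorphic_on ball (of_real R) R"
    "\<And>K. \<lbrakk>compact K; K \<subseteq> ball (of_real R) R\<rbrakk> \<Longrightarrow>
        uniform_limit K (F \<circ> s) (\<lambda>\<zeta>. \<zeta> powr of_real \<beta>) sequentially"
proof -
  define S where "S = ball (complex_of_real R) R"
  have S: "open S" "convex S" "connected S" by (auto simp: S_def)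
  have RS: "of_real R \<in> S" using R by (simp add: S_def)
  have disc: "x * (1 - of_real (r n) * \<zeta>) \<in> unit_disc" if "\<zeta> \<in> S" for n \<zeta>
    using that r(1,2) by (intro scaled_ball_in_disc[OF x]) (auto simp: S_def)
  have rC: "C * of_real (r n powr \<beta>) \<noteq> 0" for n using C r(1)[of n] by simp
  have holF: "F n holomorphic_on S" for n
    unfolding F_def using rC[of n] disc[of _ n]
    by (intro holomorphic_intros holomorphic_on_compose_gen[OF _ hol, unfolded o_def]) auto
  have injF: "inj_on (F n) S" for n
  proof (rule inj_onI)
    fix u v assume u: "u \<in> S" and v: "v \<in> S" and "F n u = F n v"
    then have "f (x * (1 - of_real (r n) * u)) = f (x * (1 - of_real (r n) * v))"
      using rC[of n] by (simp add: F_def)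
    then have "x * (1 - of_real (r n) * u) = x * (1 - of_real (r n) * v)"
      using inj_onD[OF inj _ disc[OF u] disc[OF v]] by blast
    then show "u = v" using x r(1)[of n] by auto
  qed
  have nzF: "F n \<zeta> \<noteq> 0" if "\<zeta> \<in> S" for n \<zeta>
    using nz[OF disc[OF that]] rC[of n] by (simp add: F_def)
  have real_lim: "(\<lambda>n. F n (of_real t)) \<longlonglongrightarrow> of_real t powr of_real \<beta>" if t: "t > 0" for t
  proof -
    have "filterlim (\<lambda>n. 1 - r n * t) (at_left 1) sequentially"
      unfolding filterlim_at
    proof (intro conjI)
      have "(\<lambda>n. 1 - r n * t) \<longlonglongrightarrow> 1 - 0 * t" by (intro tendsto_intros r)
      then show "(\<lambda>n. 1 - r n * t) \<longlonglongrightarrow> 1" by simp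
      show "\<forall>\<^sub>F n in sequentially. 1 - r n * t \<in> {..<1} \<and> 1 - r n * t \<noteq> 1"
        using r(1) t by (intro always_eventually) (auto simp: less_le)
    qed
    from filterlim_compose[OF lim this]
    have "(\<lambda>n. f (of_real (1 - r n * t) * x) / of_real ((1 - (1 - r n * t)) powr \<beta>) * of_real (t powr \<beta>) / C)
        \<longlonglongrightarrow> C * of_real (t powr \<beta>) / C"
      by (intro tendsto_intros C)
    moreover have "f (of_real (1 - r n * t) * x) / of_real ((1 - (1 - r n * t)) powr \<beta>) * of_real (t powr \<beta>) / C
        = F n (of_real t)" for n
      using r(1)[of n] t by (simp add: F_def powr_mult mult.commute)
    moreover have "complex_of_real t powr of_real \<beta> = of_real (t powr \<beta>)"
      using t by (simp add: powr_of_real)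
    ultimately show ?thesis using C by simp
  qed
  have "Bseq (\<lambda>n. F n (of_real R))" using real_lim[OF R] convergentI convergent_imp_Bseq by blast
  then obtain B where B: "\<And>n. cmod (F n (of_real R)) \<le> B" by (auto simp: Bseq_def)
  have bounded: "\<exists>M. \<forall>h\<in>range F. \<forall>z\<in>K. cmod (h z) \<le> M" if K: "compact K" "K \<subseteq> S" for K
  proof (cases "K = {}")
    case False
    obtain k where k: "k \<in> K" "\<And>z. z \<in> K \<Longrightarrow> dist (of_real R) z \<le> dist (of_real R) k"
      using distance_attains_sup[OF K(1) False] by metis
    \<comment> \<open>The distance from K to the boundary circle. Segments from the centre to K stay
      at least this deep inside S, so the growth bound is uniform in n; at the centre itself the
      sequence converges.\<close>
    define d where "d = R - dist (of_real R) k"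
    have d: "d > 0" using k(1) K(2) by (auto simp: S_def d_def)
    have "cmod (F n z) \<le> B * exp (12 * pi / d * R)" if z: "z \<in> K" for n z
    proof -
      have "cmod (F n z) \<le> cmod (F n (of_real R)) * exp (12 * pi / d * cmod (z - of_real R))"
      proof (rule univalent_growth_bound[OF holF injF S(1,2) nzF d])
        fix u assume "u \<in> closed_segment (of_real R) z"
        moreover have "closed_segment (of_real R) z \<subseteq> cball (of_real R) (R - d)"
          using k(2)[OF z] d R by (intro closed_segment_subset) (auto simp: d_def)
        ultimately have u: "dist (of_real R) u \<le> R - d" by auto
        show "ball u d \<subseteq> S"
        proof
          fix v assume "v \<in> ball u d"
          then show "v \<in> S" using dist_triangle[of "of_real R" v u] u by (simp add: S_def)
        qed
      qed
      also have "\<dots> \<le> B * exp (12 * pi / d * R)"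
      proof (intro mult_mono B)
        have "cmod (z - of_real R) \<le> R"
          using z K(2) by (auto simp: S_def dist_norm norm_minus_commute)
        then have "12 * pi / d * cmod (z - of_real R) \<le> 12 * pi / d * R"
          using d by (intro mult_left_mono) auto
        then show "exp (12 * pi / d * cmod (z - of_real R)) \<le> exp (12 * pi / d * R)" by simp
        show "0 \<le> B" using order_trans[OF norm_ge_zero B] .
      qed auto
      finally show ?thesis .
    qed
    then show ?thesis by blast
  qed auto
  obtain g s where g: "g holomorphic_on S" and s: "strict_mono (s :: nat \<Rightarrow> nat)"
    and ptw: "\<And>z. z \<in> S \<Longrightarrow> (\<lambda>n. F (s n) z) \<longlonglongrightarrow> g z"
    and unif: "\<And>K. \<lbrakk>compact K; K \<subseteq> S\<rbrakk> \<Longrightarrow> uniform_limit K (F \<circ> s) g sequentially"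
  proof (rule Montel[OF S(1) _ bounded order_refl])
    show "h holomorphic_on S" if "h \<in> range F" for h using that holF by blast
  qed (assumption, assumption, rule that)
  have Re: "Re z > 0" if "z \<in> S" for z
    using ball_tangent_imaginary_axis that by (simp add: S_def)
  have g_eq: "g z - z powr of_real \<beta> = 0" if z: "z \<in> S" for z
  proof (rule analytic_continuation[of "\<lambda>z. g z - z powr of_real \<beta>" S "of_real ` {0<..<2*R}" "of_real R" z])
    show "(\<lambda>z. g z - z powr of_real \<beta>) holomorphic_on S"
      using Re by (intro holomorphic_intros g) (force simp: complex_nonpos_Reals_iff)
    show "of_real ` {0<..<2*R} \<subseteq> S"
      by (auto simp: S_def dist_norm simp flip: of_real_diff)
    show "complex_of_real R islimpt of_real ` {0<..<2*R}"
    proof -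
      have "R islimpt {0<..<2*R}" using R by (simp add: islimpt_greaterThanLessThan1 interior_limit_point)
      then have "complex_of_real R islimpt of_real ` {0<..<2*R}"
        by (intro islimpt_isCont_image) (auto simp: eventually_at_filter)
      then show ?thesis .
    qed
    fix w assume "w \<in> complex_of_real ` {0<..<2*R}"
    then obtain t where t: "w = of_real t" "0 < t" "t < 2 * R" by auto
    have "w \<in> S" using t by (auto simp: S_def dist_norm simp flip: of_real_diff)
    from LIMSEQ_unique[OF ptw[OF this] LIMSEQ_subseq_LIMSEQ[OF real_lim[OF t(2)] s, unfolded o_def, folded t(1)]]
    show "g w - w powr of_real \<beta> = 0" by simp
  qed (use S RS z in auto)
  show ?thesis
  proof (rule that[OF s])
    show "F n holomorphic_on ball (of_real R) R" for n using holF by (simp add: S_def)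
    show "uniform_limit K (F \<circ> s) (\<lambda>\<zeta>. \<zeta> powr of_real \<beta>) sequentially"
      if "compact K" "K \<subseteq> ball (of_real R) R" for K
    proof (rule uniform_limit_cong'[THEN iffD1, OF _ _ unif])
      show "g z = z powr of_real \<beta>" if "z \<in> K" for z
        using g_eq[of z] \<open>K \<subseteq> _\<close> that by (auto simp: S_def)
    qed (use that in \<open>auto simp: S_def\<close>)
  qed
qed

lemma cis_powr_of_real:
  assumes "\<bar>t\<bar> < pi"
  shows "cis t powr of_real b = cis (b * t)"
proof -
  have "Ln (cis t) = \<i> * of_real t"
    using assms by (intro Ln_unique) (auto simp: cis_conv_exp)
  then show ?thesis by (simp add: powr_def cis_conv_exp mult_ac)
qed

text \<open>If no radius \<rho> works, there are omitted values in the sector that tend to its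
  vertex. Rescaling each of them to modulus one turns them into points of an arc that the limit map
  \<zeta>^\<beta> does attain, against Hurwitz's theorem.\<close>

lemma univalent_image_contains_sector:
  assumes hol: "f holomorphic_on unit_disc" and inj: "inj_on f unit_disc"
    and nz: "\<And>z. z \<in> unit_disc \<Longrightarrow> f z \<noteq> 0" and x: "cmod x = 1"
    and C: "C \<noteq> 0" and \<beta>: "\<beta> > 0"
    and lim: "((\<lambda>r. f (of_real r * x) / of_real ((1 - r) powr \<beta>)) \<longlongrightarrow> C) (at_left 1)"
    and \<theta>: "0 < \<theta>" "\<theta> < \<beta> * pi"
  shows "\<exists>\<rho>>0. \<forall>a t. \<bar>a\<bar> < \<theta> / 2 \<and> 0 < t \<and> t < \<rho> \<longrightarrow> sgn C * of_real t * cis a \<in> f ` unit_disc"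
proof (rule ccontr)
  assume neg: "\<not> ?thesis"
  \<comment> \<open>The power \<beta> maps the unit arc of half-angle \<delta> onto that of
    half-angle \<theta> / 2, and \<theta> < \<beta> \<pi> says \<delta> < \<pi> / 2. A point cis
    \<eta> lies in the disc of centre and radius R iff 2 R cos \<eta> > 1; with R = 1 / cos \<delta>
    the closed arc fits with room to spare, which matters because the limit angle A may be an
    endpoint.\<close>
  define \<delta> where "\<delta> = \<theta> / (2 * \<beta>)"
  have \<delta>: "0 < \<delta>" "\<delta> < pi / 2" using \<theta> \<beta> by (auto simp: \<delta>_def field_simps)
  have cos\<delta>: "cos \<delta> > 0" using \<delta> by (intro cos_gt_zero) auto
  define R where "R = 1 / cos \<delta>"
  have R: "R > 0" using cos\<delta> by (simp add: R_def)
  define q where "q n = 1 / (R * (real n + 1))" for n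
  have q: "q n > 0" for n using R by (simp add: q_def)
  have neg': "\<exists>a t. \<bar>a\<bar> < \<theta> / 2 \<and> 0 < t \<and> t < \<rho> \<and> sgn C * of_real t * cis a \<notin> f ` unit_disc"
    if "\<rho> > 0" for \<rho>
    using neg that by blast
  have "\<forall>n. \<exists>a t. \<bar>a\<bar> < \<theta> / 2 \<and> 0 < t \<and> t < cmod C * q n powr \<beta> \<and> sgn C * of_real t * cis a \<notin> f ` unit_disc"
  proof
    fix n
    have "cmod C * q n powr \<beta> > 0" using C q[of n] by simp
    from neg'[OF this] show "\<exists>a t. \<bar>a\<bar> < \<theta> / 2 \<and> 0 < t \<and> t < cmod C * q n powr \<beta> \<and> sgn C * of_real t * cis a \<notin> f ` unit_disc" .
  qed
  then obtain a t where a: "\<And>n. \<bar>a n\<bar> < \<theta> / 2" and t: "\<And>n. 0 < t n" "\<And>n. t n < cmod C * q n powr \<beta>"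
    and out: "\<And>n. sgn C * of_real (t n) * cis (a n) \<notin> f ` unit_disc"
    by metis
  have "\<forall>n. a n \<in> {- \<theta> / 2..\<theta> / 2}" proof
    fix n show "a n \<in> {- \<theta> / 2..\<theta> / 2}" using a[of n] by (auto simp: abs_if split: if_splits)
  qed
  then obtain A k where A: "A \<in> {- \<theta> / 2..\<theta> / 2}" and k: "strict_mono (k :: nat \<Rightarrow> nat)" "(a \<circ> k) \<longlonglongrightarrow> A"
    using seq_compactE[OF compact_imp_seq_compact[OF compact_Icc]] by blast
  \<comment> \<open>Chosen so that |C| r^\<beta> is the modulus of the omitted value; after
    rescaling, that value becomes \<open>cis (a (k n))\<close>.\<close>
  define r where "r n = (t (k n) / cmod C) powr (1 / \<beta>)" for n
  have rpos: "r n > 0" for n using t(1)[of "k n"] C by (simp add: r_def)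
  have rq: "r n < q (k n)" for n
  proof -
    have "r n < (q (k n) powr \<beta>) powr (1 / \<beta>)"
      unfolding r_def using t(1)[of "k n"] t(2)[of "k n"] C \<beta>
      by (intro powr_less_mono2) (auto simp: field_simps)
    then show ?thesis using \<beta> q[of "k n"] by (simp add: powr_powr)
  qed
  have rR: "r n * R \<le> 1" for n
  proof -
    have "r n * R \<le> q (k n) * R" using rq[of n] R by simp
    also have "\<dots> \<le> 1" using R by (simp add: q_def)
    finally show ?thesis .
  qed
  have "q \<longlonglongrightarrow> 0" unfolding q_def using R by real_asymp
  from LIMSEQ_subseq_LIMSEQ[OF this k(1)] have qk: "(\<lambda>n. q (k n)) \<longlonglongrightarrow> 0" by (simp add: o_def)
  have r0: "r \<longlonglongrightarrow> 0"
    by (rule tendsto_sandwich[OF _ _ tendsto_const qk])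
       (use rpos rq in \<open>auto intro!: always_eventually less_imp_le\<close>)
  define F where "F n \<zeta> = f (x * (1 - of_real (r n) * \<zeta>)) / (C * of_real (r n powr \<beta>))" for n \<zeta>
  define S where "S = ball (complex_of_real R) R"
  obtain s where s: "strict_mono s" "\<And>n. F n holomorphic_on S"
    and unif: "\<And>K. \<lbrakk>compact K; K \<subseteq> S\<rbrakk> \<Longrightarrow> uniform_limit K (F \<circ> s) (\<lambda>\<zeta>. \<zeta> powr of_real \<beta>) sequentially"
    by (rule univalent_scaling_limit[OF hol inj nz x C lim R rpos rR r0, folded F_def S_def])
       (assumption, rule that)
  define \<zeta>0 where "\<zeta>0 = cis (A / \<beta>)"
  have A\<delta>: "\<bar>A / \<beta>\<bar> \<le> \<delta>" using A \<beta> by (auto simp: \<delta>_def field_simps abs_le_iff)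
  have \<zeta>0: "\<zeta>0 \<in> S"
  proof -
    have "cos \<delta> \<le> cos (A / \<beta>)" using A\<delta> \<delta> cos_mono_le_eq[of \<delta> "\<bar>A / \<beta>\<bar>"] cos_abs_real[of "A / \<beta>"]
      by (simp del: cos_abs_real abs_divide)
    then have "1 \<le> R * cos (A / \<beta>)" using cos\<delta> by (simp add: R_def)
    moreover have "(cmod (of_real R - \<zeta>0))\<^sup>2 = R\<^sup>2 - 2 * (R * cos (A / \<beta>)) + ((cos (A / \<beta>))\<^sup>2 + (sin (A / \<beta>))\<^sup>2)"
      unfolding cmod_power2 by (simp add: \<zeta>0_def power2_eq_square algebra_simps)
    ultimately have "(cmod (of_real R - \<zeta>0))\<^sup>2 < R\<^sup>2" by simp
    then have "cmod (of_real R - \<zeta>0) < R" using R power2_less_imp_less[of _ R] by simp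
    then show ?thesis by (simp add: S_def dist_norm)
  qed
  have Re: "Re z > 0" if "z \<in> S" for z
    using ball_tangent_imaginary_axis that by (simp add: S_def)
  \<comment> \<open>A zero of an approximant would be a point where f takes an omitted value.
    Hurwitz's theorem carries the absence of zeros over to the limit, although \<zeta>0 is a zero of
    it.\<close>
  have "\<zeta>0 powr of_real \<beta> - cis A \<noteq> 0"
  proof (rule Hurwitz_no_zeros[of S "\<lambda>n \<zeta>. F (s n) \<zeta> - cis (a (k (s n)))" "\<lambda>\<zeta>. \<zeta> powr of_real \<beta> - cis A" \<zeta>0])
    show "open S" "connected S" "\<zeta>0 \<in> S" using \<zeta>0 by (auto simp: S_def)
    show "(\<lambda>\<zeta>. F (s n) \<zeta> - cis (a (k (s n)))) holomorphic_on S" for n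
      by (intro holomorphic_intros s)
    show "(\<lambda>\<zeta>. \<zeta> powr of_real \<beta> - cis A) holomorphic_on S"
      using Re by (intro holomorphic_intros) (force simp: complex_nonpos_Reals_iff)
    show "uniform_limit K (\<lambda>n \<zeta>. F (s n) \<zeta> - cis (a (k (s n)))) (\<lambda>\<zeta>. \<zeta> powr of_real \<beta> - cis A) sequentially"
      if K: "compact K" "K \<subseteq> S" for K
    proof (rule uniform_limit_minus)
      show "uniform_limit K (\<lambda>n. F (s n)) (\<lambda>\<zeta>. \<zeta> powr of_real \<beta>) sequentially"
        using unif[OF K] by (simp add: o_def)
      have "(\<lambda>n. a (k (s n))) \<longlonglongrightarrow> A"
        using LIMSEQ_subseq_LIMSEQ[OF k(2) s(1)] by (simp add: o_def)
      then have "(\<lambda>n. cis (a (k (s n)))) \<longlonglongrightarrow> cis A" by (intro tendsto_intros)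
      then show "uniform_limit K (\<lambda>n \<zeta>. cis (a (k (s n)))) (\<lambda>\<zeta>. cis A) sequentially"
        by (auto simp: uniform_limit_iff tendsto_iff)
    qed
    show "\<not> (\<lambda>\<zeta>. \<zeta> powr of_real \<beta> - cis A) constant_on S"
    proof
      assume "(\<lambda>\<zeta>. \<zeta> powr of_real \<beta> - cis A) constant_on S"
      moreover have "of_real R \<in> S" "of_real (R / 2) \<in> S"
        using R by (auto simp: S_def dist_norm simp del: of_real_divide simp flip: of_real_diff)
      ultimately have "complex_of_real R powr of_real \<beta> - cis A = of_real (R / 2) powr of_real \<beta> - cis A"
        unfolding constant_on_def by metis
      then have "complex_of_real (R powr \<beta>) = of_real ((R / 2) powr \<beta>)"
        using R by (simp add: powr_of_real del: of_real_divide)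
      then have "R powr \<beta> = (R / 2) powr \<beta>" by (simp only: of_real_eq_iff)
      moreover have "(R / 2) powr \<beta> < R powr \<beta>" using R \<beta> by (intro powr_less_mono2) auto
      ultimately show False by simp
    qed
    show "F (s n) \<zeta> - cis (a (k (s n))) \<noteq> 0" if "\<zeta> \<in> S" for n \<zeta>
    proof
      define m where "m = s n"
      assume "F (s n) \<zeta> - cis (a (k (s n))) = 0"
      then have "f (x * (1 - of_real (r m) * \<zeta>)) = C * of_real (r m powr \<beta>) * cis (a (k m))"
        using C rpos[of m] by (simp add: F_def m_def divide_eq_eq mult_ac)
      also have "r m powr \<beta> = t (k m) / cmod C"
        using \<beta> t(1)[of "k m"] by (simp add: r_def powr_powr)
      also have "C * of_real (t (k m) / cmod C) * cis (a (k m)) = sgn C * of_real (t (k m)) * cis (a (k m))"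
        by (simp add: sgn_eq)
      finally have "sgn C * of_real (t (k m)) * cis (a (k m)) = f (x * (1 - of_real (r m) * \<zeta>))" ..
      moreover have "x * (1 - of_real (r m) * \<zeta>) \<in> unit_disc"
        using that by (intro scaled_ball_in_disc[OF x rpos rR]) (simp add: S_def)
      ultimately show False using out[of "k m"] by blast
    qed
  qed
  moreover have "\<zeta>0 powr of_real \<beta> = cis A"
    unfolding \<zeta>0_def using A\<delta> \<delta> \<beta> by (subst cis_powr_of_real) auto
  ultimately show False by simp
qed

section \<open>Boundary distance under self-maps and sectors not inside the image\<close>

text \<open>A Moebius map moves k(0) to 0, and Schwarz's lemma then gives (1 - |w|^2) |D|^2 \<le> (1
  - |a|^2) (1 - |k(w)|^2), where a = k(0) and D = 1 - cnj(a) k(w).\<close>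

lemma self_map_boundary_distance:
  assumes hol: "k holomorphic_on ball 0 1" and lt1: "\<And>w. cmod w < 1 \<Longrightarrow> cmod (k w) < 1"
  obtains c where "c > 0" "\<And>w. cmod w < 1 \<Longrightarrow> c * (1 - (cmod w)\<^sup>2) \<le> 1 - cmod (k w)"
proof -
  define a where "a = k 0"
  have a: "cmod a < 1" using lt1 by (simp add: a_def)
  define m where "m w = Moebius_function 0 a (k w)" for w
  have mlt: "cmod (m w) < 1" if "cmod w < 1" for w
    unfolding m_def by (intro Moebius_function_norm_lt_1 a lt1 that)
  have "m holomorphic_on ball 0 1"
    unfolding m_def
    using holomorphic_on_compose_gen[OF hol Moebius_function_holomorphic[OF a, of 0]] lt1
    by (simp add: o_def image_subset_iff)
  then have le: "cmod (m w) \<le> cmod w" if "cmod w < 1" for w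
    using Schwarz_Lemma(1)[of m w] mlt that by (simp add: m_def a_def Moebius_function_eq_zero)
  \<comment> \<open>Since |D| \<ge> 1 - |a|, cancelling one factor 1 - |a| leaves another; the 4
    bounds (1 + |a|) (1 + |k(w)|).\<close>
  have "(1 - cmod a) / 4 * (1 - (cmod w)\<^sup>2) \<le> 1 - cmod (k w)" if w: "cmod w < 1" for w
  proof -
    define D where "D = 1 - cnj a * k w"
    have kw: "cmod (k w) < 1" using lt1[OF w] .
    have "cmod (cnj a * k w) \<le> cmod a" using kw by (simp add: norm_mult mult_left_le)
    then have D: "1 - cmod a \<le> cmod D"
      using norm_triangle_ineq2[of 1 "cnj a * k w"] by (simp add: D_def)
    have "D \<noteq> 0" using D a by auto
    moreover have "k w - a = m w * D"
      using \<open>D \<noteq> 0\<close> by (simp add: m_def Moebius_function_simple D_def)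
    ultimately have "(cmod (k w - a))\<^sup>2 \<le> (cmod w)\<^sup>2 * (cmod D)\<^sup>2"
      using le[OF w] by (simp add: norm_mult power_mult_distrib mult_right_mono power_mono)
    moreover have "(cmod (k w - a))\<^sup>2 = (cmod D)\<^sup>2 - (1 - (cmod a)\<^sup>2) * (1 - (cmod (k w))\<^sup>2)"
      unfolding D_def cmod_power2 by (simp add: power2_eq_square algebra_simps)
    ultimately have "(1 - (cmod w)\<^sup>2) * (cmod D)\<^sup>2 \<le> (1 - (cmod a)\<^sup>2) * (1 - (cmod (k w))\<^sup>2)"
      by (simp add: algebra_simps)
    moreover have "(1 - (cmod w)\<^sup>2) * (1 - cmod a)\<^sup>2 \<le> (1 - (cmod w)\<^sup>2) * (cmod D)\<^sup>2"
      using D a w by (intro mult_left_mono power_mono) (auto simp: abs_square_le_1)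
    moreover have "(1 - (cmod a)\<^sup>2) * (1 - (cmod (k w))\<^sup>2)
        = (1 - cmod a) * ((1 + cmod a) * (1 + cmod (k w)) * (1 - cmod (k w)))"
      by (simp add: power2_eq_square algebra_simps)
    ultimately have "(1 - cmod a) * ((1 - cmod a) * (1 - (cmod w)\<^sup>2))
        \<le> (1 - cmod a) * ((1 + cmod a) * (1 + cmod (k w)) * (1 - cmod (k w)))"
      by (simp add: power2_eq_square mult_ac)
    then have "(1 - cmod a) * (1 - (cmod w)\<^sup>2) \<le> (1 + cmod a) * (1 + cmod (k w)) * (1 - cmod (k w))"
      using a by (simp add: mult_le_cancel_left_pos)
    also have "\<dots> \<le> 2 * 2 * (1 - cmod (k w))"
      using a kw by (intro mult_mono) auto
    finally show ?thesis by simp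
  qed
  then show ?thesis using a by (intro that[of "(1 - cmod a) / 4"]) auto
qed

text \<open>If the sector were contained in the image, \<open>\<zeta> \<mapsto> \<zeta> powr (\<theta> / \<pi>)\<close> followed by the inverse of \<open>f\<close> would map
  a disc tangent to the imaginary axis into the unit disc.  By Schwarz--Pick the boundary distance
  decays at most linearly there, whereas along the radius it is \<open>o(|\<zeta>|)\<close>.  Since only the map
  matters, sectors with \<open>\<theta> > 2 \<pi>\<close>, which overlap themselves, need no separate treatment.\<close>

lemma univalent_image_not_contains_sector:
  assumes hol: "f holomorphic_on unit_disc" and inj: "inj_on f unit_disc" and x: "cmod x = 1"
    and C: "C \<noteq> 0" and \<beta>: "\<beta> > 0"
    and lim: "((\<lambda>r. f (of_real r * x) / of_real ((1 - r) powr \<beta>)) \<longlongrightarrow> C) (at_left 1)"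
    and \<theta>: "\<theta> > \<beta> * pi" and \<rho>: "\<rho> > 0"
  shows "\<exists>a t. \<bar>a\<bar> < \<theta> / 2 \<and> 0 < t \<and> t < \<rho> \<and> sgn C * of_real t * cis a \<notin> f ` unit_disc"
proof (rule ccontr)
  assume neg: "\<not> ?thesis"
  then have sec: "sgn C * of_real t * cis a \<in> f ` unit_disc" if "\<bar>a\<bar> < \<theta> / 2" "0 < t" "t < \<rho>" for a t
    using that by blast
  define \<gamma> where "\<gamma> = \<theta> / pi"
  have "\<gamma> > \<beta>" using \<theta> by (simp add: \<gamma>_def field_simps)
  with \<beta> have \<gamma>: "\<gamma> > \<beta>" "\<gamma> > 0" by auto
  \<comment> \<open>The disc of centre and radius s lies in |\<zeta>| < 2 s, which the power
    \<gamma> maps to moduli below \<rho>.\<close>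
  define s where "s = \<rho> powr (1 / \<gamma>) / 2"
  have s: "s > 0" "(2 * s) powr \<gamma> = \<rho>" using \<rho> \<gamma> by (auto simp: s_def powr_powr)
  define P where "P \<zeta> = sgn C * \<zeta> powr of_real \<gamma>" for \<zeta> :: complex
  have op: "open unit_disc" by (simp add: unit_disc_def)
  obtain g where g: "g holomorphic_on f ` unit_disc" "\<And>z. z \<in> unit_disc \<Longrightarrow> g (f z) = z"
    using holomorphic_has_inverse[OF hol op inj] by metis
  have half_plane: "Re (of_real s * (1 + w)) > 0" "cmod (of_real s * (1 + w)) < 2 * s" if "cmod w < 1" for w
  proof -
    have "- Re w \<le> cmod w" using abs_Re_le_cmod[of w] by linarith
    then show "Re (of_real s * (1 + w)) > 0" using s(1) that by simp
    have "cmod (1 + w) < 2" using norm_triangle_ineq[of 1 w] that by simp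
    then show "cmod (of_real s * (1 + w)) < 2 * s" using s(1) by (simp add: norm_mult)
  qed
  have P_in: "P \<zeta> \<in> f ` unit_disc" if "Re \<zeta> > 0" "cmod \<zeta> < 2 * s" for \<zeta>
  proof -
    have nz: "\<zeta> \<noteq> 0" using that(1) by auto
    have "\<zeta> powr of_real \<gamma> = of_real (cmod \<zeta> powr \<gamma>) * cis (\<gamma> * Im (Ln \<zeta>))"
    proof -
      have "of_real \<gamma> * Ln \<zeta> = of_real (\<gamma> * ln (cmod \<zeta>)) + \<i> * of_real (\<gamma> * Im (Ln \<zeta>))"
        using nz by (simp add: complex_eq_iff)
      then have "\<zeta> powr of_real \<gamma> = of_real (exp (\<gamma> * ln (cmod \<zeta>))) * cis (\<gamma> * Im (Ln \<zeta>))"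
        by (simp only: powr_def nz if_False exp_add exp_of_real cis_conv_exp)
      then show ?thesis using nz by (simp add: powr_def)
    qed
    moreover have "\<bar>\<gamma> * Im (Ln \<zeta>)\<bar> < \<theta> / 2"
    proof -
      have "\<bar>Im (Ln \<zeta>)\<bar> < pi / 2" using Re_Ln_pos_lt[OF nz] that(1) by simp
      then show ?thesis using \<gamma> by (simp add: abs_mult \<gamma>_def field_simps)
    qed
    moreover have "cmod \<zeta> powr \<gamma> < \<rho>"
      using powr_less_mono2[OF \<gamma>(2) _ that(2)] s(2) by simp
    ultimately show ?thesis
      using sec[of "\<gamma> * Im (Ln \<zeta>)" "cmod \<zeta> powr \<gamma>"] nz by (simp add: P_def mult.assoc)
  qed
  define k where "k w = g (P (of_real s * (1 + w)))" for w
  have k_in: "k w \<in> unit_disc" if "cmod w < 1" for w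
    using P_in[OF half_plane[OF that]] g(2) by (auto simp: k_def)
  have k_hol: "k holomorphic_on ball 0 1"
    unfolding k_def
  proof (rule holomorphic_on_compose_gen[of "\<lambda>w. P (of_real s * (1 + w))" _ g "f ` unit_disc", unfolded o_def])
    show "(\<lambda>w. P (of_real s * (1 + w))) holomorphic_on ball 0 1"
      unfolding P_def
    proof (intro holomorphic_intros)
      fix w :: complex assume "w \<in> ball 0 1"
      then show "of_real s * (1 + w) \<notin> \<real>\<^sub>\<le>\<^sub>0"
        using half_plane(1)[of w] by (auto simp: complex_nonpos_Reals_iff)
    qed
  qed (use g(1) P_in half_plane in auto)
  obtain c where c: "c > 0" "\<And>w. cmod w < 1 \<Longrightarrow> c * (1 - (cmod w)\<^sup>2) \<le> 1 - cmod (k w)"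
    using self_map_boundary_distance[OF k_hol] k_in by (auto simp: unit_disc_def)
  \<comment> \<open>Here f(rx) = sgn C (1 - r)^\<beta> y(r) with y(r) tending to |C|. Its preimage
    under \<open>P\<close> is m(r) q(r), nearly positive real and of size (1 -
    r)^(\<beta>/\<gamma>). As \<beta> < \<gamma>, this is much larger than 1 - r, the boundary
    distance of rx; the contradiction comes from there.\<close>
  define y where "y r = f (of_real r * x) / of_real ((1 - r) powr \<beta>) / sgn C" for r
  define q where "q r = y r powr of_real (1 / \<gamma>)" for r
  define m where "m r = (1 - r) powr (\<beta> / \<gamma>)" for r :: real
  define q0 where "q0 = cmod C powr (1 / \<gamma>)"
  have q0: "q0 > 0" using C by (simp add: q0_def)
  have "C / sgn C = of_real (cmod C)" using C by (simp add: sgn_eq)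
  moreover have "(y \<longlongrightarrow> C / sgn C) (at_left 1)"
    unfolding y_def using C by (intro tendsto_intros lim) (auto simp: sgn_zero_iff)
  ultimately have ylim: "(y \<longlongrightarrow> of_real (cmod C)) (at_left 1)" by simp
  have CR: "complex_of_real (cmod C) \<notin> \<real>\<^sub>\<le>\<^sub>0" using C by simp
  have "((\<lambda>r. y r powr of_real (1 / \<gamma>)) \<longlongrightarrow> of_real (cmod C) powr of_real (1 / \<gamma>)) (at_left 1)"
    by (intro tendsto_powr_complex[OF CR ylim] tendsto_const)
  then have qlim: "(q \<longlongrightarrow> of_real q0) (at_left 1)"
    using C unfolding q_def q0_def by (subst (asm) powr_of_real) auto
  have m0: "(m \<longlongrightarrow> 0) (at_left 1)"
    unfolding m_def using \<beta> \<gamma> by (auto intro!: tendsto_eq_intros eventually_at_left_1I)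
  have mpos: "m r > 0" if "r < 1" for r using that by (simp add: m_def)
  \<comment> \<open>Keeps Ln(y) / \<gamma> in the principal strip, so that the power \<gamma> undoes
    the power 1 / \<gamma>.\<close>
  have arg: "\<forall>\<^sub>F r in at_left 1. \<bar>Im (Ln (y r))\<bar> < \<gamma> * pi"
  proof -
    have "((\<lambda>r. Im (Ln (y r))) \<longlongrightarrow> Im (Ln (of_real (cmod C)))) (at_left 1)"
      by (intro tendsto_intros ylim CR)
    then have "((\<lambda>r. \<bar>Im (Ln (y r))\<bar>) \<longlongrightarrow> 0) (at_left 1)"
      using C by (intro tendsto_rabs_zero) (simp add: Im_Ln_eq_0)
    then show ?thesis using \<gamma> by (intro order_tendstoD) auto
  qed
  have ynz: "\<forall>\<^sub>F r in at_left 1. y r \<noteq> 0"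
    using tendsto_imp_eventually_ne[OF ylim] C by simp
  \<comment> \<open>The coordinate of m(r) q(r) in the unit disc, with \<zeta> = s (1 + w). It tends
    to -1 along the normal direction, so 1 - |w|^2 is m(r) times a factor \<open>u r\<close> with
    the positive limit 2 q0 / s.\<close>
  define w where "w r = of_real (m r) * q r / of_real s - 1" for r
  have w_sq: "1 - (cmod (w r))\<^sup>2 = m r * (2 * Re (q r) / s - m r * (cmod (q r))\<^sup>2 / s\<^sup>2)" for r
  proof -
    have "(cmod (w r))\<^sup>2 = (m r * Re (q r) / s - 1)\<^sup>2 + (m r * Im (q r) / s)\<^sup>2"
      by (simp add: w_def cmod_power2)
    moreover have "(cmod (q r))\<^sup>2 = (Re (q r))\<^sup>2 + (Im (q r))\<^sup>2" by (simp add: cmod_power2)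
    ultimately show ?thesis using s(1) by (simp only: power2_eq_square) (simp add: field_simps)
  qed
  define u where "u r = 2 * Re (q r) / s - m r * (cmod (q r))\<^sup>2 / s\<^sup>2" for r
  have "(u \<longlongrightarrow> 2 * Re (of_real q0) / s - 0 * (cmod (of_real q0))\<^sup>2 / s\<^sup>2) (at_left 1)"
    unfolding u_def using s(1) by (intro tendsto_intros qlim m0) auto
  then have ulim: "(u \<longlongrightarrow> 2 * q0 / s) (at_left 1)" by simp
  have upos: "\<forall>\<^sub>F r in at_left 1. u r > 0"
    using order_tendstoD(1)[OF ulim, of 0] q0 s(1) by simp
  have "\<forall>\<^sub>F r in at_left 1. 0 < r \<and> r < (1::real)" by (rule eventually_at_left_1I) simp
  with arg ynz upos have "\<forall>\<^sub>F r in at_left 1. c * u r \<le> (1 - r) powr (1 - \<beta> / \<gamma>)"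
  proof eventually_elim
    case (elim r)
    then have mr: "m r > 0" by (simp add: mpos)
    then have "1 - (cmod (w r))\<^sup>2 > 0" using w_sq[of r] elim by (simp add: u_def[symmetric])
    then have "(cmod (w r))\<^sup>2 < 1" by simp
    then have wr: "cmod (w r) < 1" by (simp add: abs_square_less_1)
    have "(of_real (m r) * q r) powr of_real \<gamma> = of_real ((1 - r) powr \<beta>) * y r"
    proof -
      have "Ln (of_real (m r) * q r) = of_real (ln (m r)) + of_real (1 / \<gamma>) * Ln (y r)"
      proof (rule Ln_unique)
        show "exp (of_real (ln (m r)) + of_real (1 / \<gamma>) * Ln (y r)) = of_real (m r) * q r"
          using elim mr by (simp add: exp_add exp_of_real q_def powr_def)
        have "\<bar>Im (of_real (ln (m r)) + of_real (1 / \<gamma>) * Ln (y r))\<bar> < pi"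
          using elim(1) \<gamma> by (simp add: abs_mult field_simps)
        then show "- pi < Im (of_real (ln (m r)) + of_real (1 / \<gamma>) * Ln (y r))"
          "Im (of_real (ln (m r)) + of_real (1 / \<gamma>) * Ln (y r)) \<le> pi" by linarith+
      qed
      moreover have "of_real \<gamma> * complex_of_real (ln (m r)) = of_real (\<beta> * ln (1 - r))"
        using \<gamma> elim by (simp add: m_def ln_powr)
      moreover have "of_real \<gamma> * (of_real (1 / \<gamma>) * Ln (y r)) = Ln (y r)" using \<gamma> by simp
      moreover have "of_real (m r) * q r \<noteq> 0" using mr elim by (simp add: q_def)
      ultimately have "(of_real (m r) * q r) powr of_real \<gamma> = exp (of_real (\<beta> * ln (1 - r)) + Ln (y r))"
        by (simp only: powr_def if_False distrib_left)
      also have "\<dots> = of_real (exp (\<beta> * ln (1 - r))) * y r"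
        using exp_Ln[OF elim(2)] by (simp only: exp_add exp_of_real)
      finally show ?thesis using elim by (simp add: powr_def)
    qed
    then have "P (of_real s * (1 + w r)) = f (of_real r * x)"
      using s(1) C elim by (simp add: P_def w_def y_def sgn_zero_iff)
    then have "k (w r) = of_real r * x"
      using g(2)[OF radius_in_disc[OF x]] elim by (simp add: k_def)
    then have "c * (1 - (cmod (w r))\<^sup>2) \<le> 1 - r"
      using c(2)[OF wr] elim x by (simp add: norm_mult)
    then have "m r * (c * u r) \<le> 1 - r"
      unfolding w_sq u_def[symmetric] by (simp add: mult_ac)
    also have "1 - r = m r * (1 - r) powr (1 - \<beta> / \<gamma>)"
      using elim by (simp add: m_def flip: powr_add)
    finally show ?case using mr by (simp add: mult_le_cancel_left_pos)
  qed
  moreover have "((\<lambda>r::real. (1 - r) powr (1 - \<beta> / \<gamma>)) \<longlongrightarrow> 0) (at_left 1)"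
    using \<gamma> by (auto intro!: tendsto_eq_intros eventually_at_left_1I)
  ultimately have "c * (2 * q0 / s) \<le> 0"
    by (intro tendsto_le[OF trivial_limit_at_left_real _ tendsto_mult_left[OF ulim]])
  then show False using c(1) q0 s(1) by (simp add: mult_le_0_iff divide_le_0_iff)
qed

theorem theorem6p7:
  fixes \<phi> :: "real \<Rightarrow> complex \<Rightarrow> complex" and G h :: "complex \<Rightarrow> complex"
    and \<tau> x :: complex and \<alpha> :: real
  assumes "one_param_semigroup \<phi>"
    and "is_generator \<phi> G"
    and "denjoy_wolff_point \<phi> \<tau>"
    and "koenigs_function \<phi> G \<tau> h"
    and "cmod x = 1"
    and "-1 \<le> \<alpha>" and "\<alpha> < 1" and "\<alpha> \<noteq> 0"
    and "regular_singularity G x \<alpha>"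
  shows "\<exists>hx. angular_limit h x hx \<and>
           (\<exists>\<nu>. ((\<lambda>r. (hx - h (of_real r * x)) / of_real (cmod (hx - h (of_real r * x))))
                    \<longlongrightarrow> \<nu>) (at_left 1) \<and>
                (\<forall>\<theta>. 0 < \<theta> \<and> \<theta> < (1 - \<alpha>) * pi \<longrightarrow>
                    (\<exists>\<rho>>0. sector hx \<nu> \<theta> \<rho> \<subseteq> h ` unit_disc)) \<and>
                (\<forall>\<theta> \<rho>. \<theta> > (1 - \<alpha>) * pi \<and> \<rho> > 0 \<longrightarrow>
                    \<not> sector hx \<nu> \<theta> \<rho> \<subseteq> h ` unit_disc))"
proof -
  have hol: "h holomorphic_on unit_disc" and inj: "inj_on h unit_disc"
    using assms(4) by (auto simp: koenigs_function_def)
  note x = \<open>cmod x = 1\<close>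
  define \<beta> where "\<beta> = 1 - \<alpha>"
  have \<beta>: "\<beta> > 0" using assms(7) by (simp add: \<beta>_def)
  obtain hx C where C: "C \<noteq> 0" and hx: "((\<lambda>r. h (of_real r * x)) \<longlongrightarrow> hx) (at_left 1)"
    and lim: "((\<lambda>r. (hx - h (of_real r * x)) / of_real ((1 - r) powr \<beta>)) \<longlongrightarrow> C) (at_left 1)"
    by (rule koenigs_radial_asymptotics[OF assms(1,2,4,5,7,9), folded \<beta>_def]) (rule that)
  define f where "f z = hx - h z" for z
  have f_hol: "f holomorphic_on unit_disc"
    unfolding f_def by (intro holomorphic_intros hol)
  have f_inj: "inj_on f unit_disc"
    using inj by (auto simp: inj_on_def f_def)
  have f_nz: "f z \<noteq> 0" if "z \<in> unit_disc" for z
    using boundary_value_not_attained[OF hol inj x hx] that by (auto simp: f_def)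
  have f_lim: "((\<lambda>r. f (of_real r * x) / of_real ((1 - r) powr \<beta>)) \<longlongrightarrow> C) (at_left 1)"
    using lim by (simp add: f_def)
  have mem: "hx - sgn C * of_real t * cis a \<in> h ` unit_disc \<longleftrightarrow> sgn C * of_real t * cis a \<in> f ` unit_disc" for t a
    by (force simp: f_def image_iff algebra_simps)
  have "angular_limit h x hx"
    unfolding angular_limit_def
  proof (intro allI impI)
    fix K :: real assume "K > 1"
    with univalent_angular_limit_zero[OF f_hol f_inj f_nz x radial_limit_zero[OF \<beta> f_lim]]
    have "(f \<longlongrightarrow> 0) (at x within {z \<in> unit_disc. cmod (x - z) < K * (1 - cmod z)})"
      by (simp add: angular_limit_def)
    from tendsto_diff[OF tendsto_const[of hx] this]
    show "(h \<longlongrightarrow> hx) (at x within {z \<in> unit_disc. cmod (x - z) < K * (1 - cmod z)})"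
      by (simp add: f_def)
  qed
  \<comment> \<open>Division by the positive number (1 - r)^\<beta> does not change the direction,
    so the limit is the direction of C.\<close>
  moreover have "((\<lambda>r. (hx - h (of_real r * x)) / of_real (cmod (hx - h (of_real r * x)))) \<longlongrightarrow> sgn C) (at_left 1)"
  proof (rule Lim_transform_eventually[OF tendsto_sgn[OF lim C]])
    have "sgn ((hx - h (of_real r * x)) / of_real ((1 - r) powr \<beta>))
        = (hx - h (of_real r * x)) / of_real (cmod (hx - h (of_real r * x)))" if "r < 1" for r
      using that by (simp add: sgn_eq norm_divide)
    then show "\<forall>\<^sub>F r in at_left 1. sgn ((hx - h (of_real r * x)) / of_real ((1 - r) powr \<beta>))
        = (hx - h (of_real r * x)) / of_real (cmod (hx - h (of_real r * x)))"
      by (intro eventually_at_left_1I)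
  qed
  moreover have "\<exists>\<rho>>0. sector hx (sgn C) \<theta> \<rho> \<subseteq> h ` unit_disc" if \<theta>: "0 < \<theta>" "\<theta> < (1 - \<alpha>) * pi" for \<theta>
  proof -
    obtain \<rho> where \<rho>: "\<rho> > 0" and
      sub: "\<And>a t. \<bar>a\<bar> < \<theta> / 2 \<and> 0 < t \<and> t < \<rho> \<Longrightarrow> sgn C * of_real t * cis a \<in> f ` unit_disc"
      using univalent_image_contains_sector[OF f_hol f_inj f_nz x C \<beta> f_lim \<theta>[folded \<beta>_def]]
      by blast
    show ?thesis
      using sub mem by (intro exI[of _ \<rho>] conjI \<rho>) (auto simp: sector_def)
  qed
  moreover have "\<not> sector hx (sgn C) \<theta> \<rho> \<subseteq> h ` unit_disc" if "\<theta> > (1 - \<alpha>) * pi" "\<rho> > 0" for \<theta> \<rho>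
  proof -
    have "\<theta> > \<beta> * pi" using that by (simp add: \<beta>_def)
    from univalent_image_not_contains_sector[OF f_hol f_inj x C \<beta> f_lim this that(2)]
    obtain a t where "\<bar>a\<bar> < \<theta> / 2" "0 < t" "t < \<rho>" "hx - sgn C * of_real t * cis a \<notin> h ` unit_disc"
      unfolding mem by blast
    then show ?thesis unfolding sector_def by blast
  qed
  ultimately show ?thesis by blast
qed

end
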